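(* Let $p,q$ be primes with $q\equiv 3 \pmod 4$, $p\equiv 1 \pmod q$ and $p\equiv 3\pmod 4$. Let $H$ be the subgroup of squares in $(\mathbb{Z}/q\mathbb{Z})^{*}$, let $$\beta = \frac{1}{q}\sum_{\substack{1\le i\le q-1\\ -i\in H}} i ,$$ and let $a$ be defined by $4p^{h(-q)}=a^2+qb^2$, where $a\equiv 2 \pmod q$ ($a,b$ integers). Then the following two statements are equivalent. (1) The biconditional $$\Bigg[\ \prod_{\substack{1\le k\le (q-1)/2\\ (q+1)/2 -k \equiv 1 \bmod 2}}\Pi_{k}^{(q)}\ \text{ is a quadratic residue modulo } p\ \Bigg]\iff \Bigg[\ \left(\frac{a}{p}\right) = \left(\frac{(-1)^{\beta} \prod_{1\le i\le q-1,\ -i\in H}\left(i\,\frac{p-1}{q}\right)!}{p}\right)\ \Bigg]$$ holds. (2) $$\left(\frac{a}{p}\right) = (-1)^{(q+1)/4}.$$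
   Context: For $k=1,\dots,q$, $\Pi_{k}^{(q)}=\prod_{j=(k-1)(p-1)/q+1}^{k(p-1)/q}j$. The symbol $\left(\frac{\cdot}{p}\right)$ is the Legendre symbol modulo $p$: for an element of $(\mathbb{Z}/p\mathbb{Z})^{*}$ it is $1$ if the element is a quadratic residue modulo $p$ and $-1$ otherwise. $h(-q)$ is the class number of the imaginary quadratic field $\mathbb{Q}(\sqrt{-q})$. The condition "$-i\in H$" means that the class of $-i$ modulo $q$ lies in $H$. *)

theory Defs
  imports Complex_Main "HOL-Computational_Algebra.Polynomial" "HOL-Algebra.Ideal"
    "HOL-Number_Theory.Number_Theory"
begin

section \<open>Class numbers of quadratic fields\<close>

text \<open>Number fields are represented as subsets of the complex numbers.\<close>

definition quadratic_field :: "int \<Rightarrow> complex set" where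
  "quadratic_field d = {of_rat u + of_rat v * csqrt (of_int d) | u v. True}"

definition ring_of_integers :: "complex set \<Rightarrow> complex ring" where
  "ring_of_integers K =
     \<lparr>carrier = {x \<in> K. algebraic_int x}, monoid.mult = (*), one = 1, zero = 0, add = (+)\<rparr>"

definition nonzero_ideals :: "complex set \<Rightarrow> complex set set" where
  "nonzero_ideals K = {I. ideal I (ring_of_integers K) \<and> I \<noteq> {0}}"

text \<open>
  Every fractional ideal is a nonzero scalar multiple of an integral one, so the quotient of the
  nonzero integral ideals by the relation \<open>x I = y J\<close>, with \<open>x\<close> and \<open>y\<close> nonzero integers of the
  field, is the ideal class group.
\<close>

definition ideal_class_rel :: "complex set \<Rightarrow> (complex set \<times> complex set) set" where
  "ideal_class_rel K =
     {(I, J). I \<in> nonzero_ideals K \<and> J \<in> nonzero_ideals K \<and>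
        (\<exists>x \<in> carrier (ring_of_integers K) - {0}. \<exists>y \<in> carrier (ring_of_integers K) - {0}.
           (*) x ` I = (*) y ` J)}"

definition class_number :: "complex set \<Rightarrow> nat" where
  "class_number K = card (nonzero_ideals K // ideal_class_rel K)"


section \<open>Squares modulo a prime\<close>

definition unit_squares :: "nat \<Rightarrow> int set" where
  "unit_squares q =
     (\<lambda>x. x [^]\<^bsub>residue_ring (int q)\<^esub> (2::nat)) ` Units (residue_ring (int q))"

definition neg_square_indices :: "nat \<Rightarrow> nat set" where
  "neg_square_indices q = {i \<in> {1..q - 1}. (- int i) mod int q \<in> unit_squares q}"

definition beta :: "nat \<Rightarrow> rat" where
  "beta q = (1 / of_nat q) * (\<Sum>i \<in> neg_square_indices q. of_nat i)"

text \<open>The divisions by \<open>q\<close> in the bounds are exact when \<open>q\<close> divides \<open>p - 1\<close>.\<close>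

definition Pi_block :: "nat \<Rightarrow> nat \<Rightarrow> nat \<Rightarrow> nat" where
  "Pi_block p q k = (\<Prod>j = (k - 1) * (p - 1) div q + 1 .. k * (p - 1) div q. j)"

text \<open>
  The rational number \<open>beta q\<close> is an integer for every prime \<open>q > 3\<close> with \<open>q mod 4 = 3\<close> (lemma
  \<open>beta_integral\<close> below), so that \<open>(- 1) ^ nat \<lfloor>beta q\<rfloor>\<close> is then literally the sign with exponent
  \<open>beta q\<close>. In the remaining case \<open>beta 3 = 2 / 3\<close>, taking the floor is a convention.

  The library's \<open>Legendre\<close> is extended by the value \<open>0\<close> to multiples of \<open>p\<close>, where the symbol used
  here is not defined; statements about \<open>Legendre a p\<close> therefore carry the hypothesis that \<open>a\<close> is
  coprime to \<open>p\<close>. Given \<open>4 * p ^ h = a\<^sup>2 + q * b\<^sup>2\<close> with \<open>h\<close> the class number and \<open>[a = 2] (mod q)\<close>,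
  it also excludes, for \<open>q > 3\<close>, the solutions that come from a smaller power of \<open>p\<close> multiplied by
  a power of \<open>p\<close>, and thereby makes \<open>a\<close> unique.
\<close>

lemma unit_squares_iff_QuadRes:
  assumes "prime q" "i \<in> {1..q - 1}"
  shows "(- int i) mod int q \<in> unit_squares q \<longleftrightarrow> QuadRes (int q) (- int i)"
proof -
  interpret residues_prime q "residue_ring (int q)"
    using assms(1) by unfold_locales simp_all
  have pw: "x [^]\<^bsub>residue_ring (int q)\<^esub> (2::nat) = x\<^sup>2 mod int q"
    if "x \<in> {0..int q - 1}" for x
    using pow_cong[of x 2] that mod_pos_pos_trivial[of x "int q"] by simp
  have un: "Units (residue_ring (int q)) = {1..int q - 1}"
    using res_prime_units_eq prime_ge_1_nat[OF assms(1)] by (simp add: of_nat_diff)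
  have nz: "\<not> int q dvd - int i"
    using assms(2) by (auto dest: dvd_imp_le)
  show ?thesis
  proof
    assume "(- int i) mod int q \<in> unit_squares q"
    then obtain x where "x \<in> {1..int q - 1}" "(- int i) mod int q = x\<^sup>2 mod int q"
      unfolding unit_squares_def un using pw by auto
    then show "QuadRes (int q) (- int i)"
      unfolding QuadRes_def cong_def by (intro exI[of _ x]) simp
  next
    assume "QuadRes (int q) (- int i)"
    then obtain y where y: "y\<^sup>2 mod int q = (- int i) mod int q"
      unfolding QuadRes_def cong_def by auto
    have "y mod int q \<noteq> 0"
    proof
      assume "y mod int q = 0"
      then have "int q dvd y\<^sup>2" by (auto simp: power2_eq_square)
      then have "(- int i) mod int q = 0" using y by auto
      then show False using nz mod_0_imp_dvd by blast
    qed
    moreover have "0 \<le> y mod int q" "y mod int q < int q"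
      using assms(1) by (auto simp: prime_gt_0_nat)
    ultimately have r: "y mod int q \<in> {1..int q - 1}" by auto
    have "(- int i) mod int q = (y mod int q) [^]\<^bsub>residue_ring (int q)\<^esub> (2::nat)"
      using pow_cong[of y 2] y by simp
    then show "(- int i) mod int q \<in> unit_squares q"
      unfolding unit_squares_def un using r by blast
  qed
qed

lemma beta_integral:
  assumes "prime q" "q mod 4 = 3" "q > 3"
  shows "of_int \<lfloor>beta q\<rfloor> = beta q"
proof -
  let ?N = "neg_square_indices q"
  define f where "f = (\<lambda>i::nat. 4 * i mod q)"
  have N: "?N = {i \<in> {1..q - 1}. QuadRes (int q) (- int i)}"
    unfolding neg_square_indices_def using unit_squares_iff_QuadRes[OF assms(1)] by blast
  have "odd q" using assms(2) by presburger
  then have "coprime (2 * 2) q" unfolding coprime_mult_left_iff by simp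
  then have odd: "coprime 4 q" by simp
  have "f ` ?N \<subseteq> ?N"
  proof
    fix j assume "j \<in> f ` ?N"
    then obtain i where i: "i \<in> {1..q - 1}" "QuadRes (int q) (- int i)" "j = 4 * i mod q"
      unfolding N f_def by blast
    obtain y where y: "[y\<^sup>2 = - int i] (mod int q)" using i(2) unfolding QuadRes_def by blast
    have "[4 * y\<^sup>2 = 4 * (- int i)] (mod int q)" by (rule cong_scalar_left[OF y])
    moreover have "[4 * (- int i) = - int j] (mod int q)"
    proof -
      have "[4 * int i = int j] (mod int q)" unfolding i(3) cong_def zmod_int by simp
      then have "[- (4 * int i) = - int j] (mod int q)" by (simp only: cong_minus_minus_iff)
      then show ?thesis by simp
    qed
    ultimately have sq: "[(2 * y)\<^sup>2 = - int j] (mod int q)"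
      unfolding power_mult_distrib by (simp add: cong_def)
    have "j \<noteq> 0"
    proof
      assume "j = 0"
      then have "q dvd 4 * i" using i(3) by auto
      then have "q dvd i" using odd by (simp add: coprime_commute coprime_dvd_mult_right_iff)
      then show False using i(1) by (auto dest: dvd_imp_le)
    qed
    moreover have "j < q" using i(3) assms(3) by simp
    moreover have "QuadRes (int q) (- int j)" unfolding QuadRes_def using sq by blast
    ultimately show "j \<in> ?N" unfolding N by simp
  qed
  moreover have inj: "inj_on f ?N"
  proof (rule inj_onI)
    fix i j assume ij: "i \<in> ?N" "j \<in> ?N" "f i = f j"
    then have "[4 * i = 4 * j] (mod q)" by (simp add: f_def cong_def)
    then have "[i = j] (mod q)" using odd by (simp add: cong_mult_lcancel_nat)
    then show "i = j" using ij unfolding N by (auto simp: cong_def)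
  qed
  moreover have fin: "finite ?N" unfolding N by simp
  ultimately have im: "f ` ?N = ?N" by (simp add: endo_inj_surj)
  have "[(\<Sum>i\<in>?N. 4 * i) = (\<Sum>i\<in>?N. f i)] (mod q)"
    by (rule cong_sum) (simp add: f_def cong_def)
  also have "(\<Sum>i\<in>?N. f i) = \<Sum>?N"
    using sum.reindex[OF inj, of "\<lambda>x. x"] im by simp
  also have "(\<Sum>i\<in>?N. 4 * i) = \<Sum>?N + 3 * \<Sum>?N"
    by (simp add: sum_distrib_left[symmetric])
  finally have "[\<Sum>?N + 3 * \<Sum>?N = \<Sum>?N] (mod q)" .
  then have "[3 * \<Sum>?N = 0] (mod q)"
    by (rule iffD1[OF cong_add_lcancel_0_nat])
  then have "q dvd 3 * \<Sum>?N" by (simp add: cong_0_iff)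
  moreover have "\<not> q dvd 3" using assms(3) by (auto dest: dvd_imp_le)
  ultimately have "q dvd \<Sum>?N" using assms(1) by (simp add: prime_dvd_mult_iff)
  then obtain m where m: "\<Sum>?N = q * m" by blast
  have "beta q = of_int (int m)"
  proof -
    have "(\<Sum>i\<in>?N. of_nat i) = (of_nat (q * m) :: rat)" using m by (simp flip: of_nat_sum)
    then show ?thesis using assms(3) by (simp add: beta_def)
  qed
  then show ?thesis by simp
qed

end

theory Submission
  imports Defs
begin

text \<open>
  Write \<open>\<chi>\<close> for the Legendre symbol modulo \<open>p\<close>, and put \<open>f = (p - 1) / q\<close>, \<open>m = (q - 1) / 2\<close> and
  \<open>F\<^sub>i = (i f)!\<close>. Since \<open>\<Pi>\<^sub>k = F\<^sub>k / F\<^sub>k\<^sub>-\<^sub>1\<close> and \<open>m\<close> is odd, the product of the \<open>\<Pi>\<^sub>k\<close> over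
  odd \<open>k \<le> m\<close> has the symbol \<open>\<chi>(F\<^sub>1) \<dots> \<chi>(F\<^sub>m)\<close>. By Wilson's theorem \<open>\<chi>(F\<^sub>q\<^sub>-\<^sub>i) = - \<chi>(F\<^sub>i)\<close>,
  so \<open>(- 1)\<^sup>i \<chi>(F\<^sub>i)\<close> is invariant under \<open>i \<mapsto> q - i\<close>. The set of \<open>i\<close> with \<open>- i \<in> H\<close> contains exactly
  one of \<open>i\<close> and \<open>q - i\<close>, and the sum of its elements has the parity of \<open>\<beta>\<close>; hence the symbol of
  \<open>(- 1)\<^sup>\<beta> \<Prod>F\<^sub>i\<close> over this set is the product of the \<open>(- 1)\<^sup>i \<chi>(F\<^sub>i)\<close> with \<open>i \<le> m\<close>, which differs from
  the first symbol by the factor \<open>(- 1)\<close> to the power \<open>m (m + 1) / 2 \<equiv> (q + 1) / 4\<close>. The symbol of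
  \<open>a\<close> occurs on both sides and cancels, so that class numbers play no role.
\<close>

section \<open>The Legendre symbol\<close>

lemma Legendre_cong:
  assumes "[x = y] (mod p)"
  shows "Legendre x p = Legendre y p"
proof -
  have "[x = 0] (mod p) \<longleftrightarrow> [y = 0] (mod p)" "QuadRes p x \<longleftrightarrow> QuadRes p y"
    using assms unfolding QuadRes_def cong_def by auto
  then show ?thesis by (simp add: Legendre_def)
qed

lemma Legendre_cases: "Legendre x p \<in> {- 1, 0, 1}"
  by (simp add: Legendre_def)

lemma Legendre_eq_0_iff: "Legendre x p = 0 \<longleftrightarrow> p dvd x"
  by (simp add: Legendre_def cong_0_iff)

lemma QuadRes_iff_Legendre:
  assumes "\<not> p dvd x"
  shows "QuadRes p x \<longleftrightarrow> Legendre x p = 1"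
  using assms by (simp add: Legendre_def cong_0_iff)

text \<open>Two elements of {-1, 0, 1} differ by at most 2, which is less than \<open>p\<close>.
  This turns congruences from Euler's criterion into equalities.\<close>

lemma sign_eqI_cong:
  fixes u v :: int
  assumes "[u = v] (mod int p)" "p > 2" "u \<in> {- 1, 0, 1}" "v \<in> {- 1, 0, 1}"
  shows "u = v"
proof -
  have "int p dvd u - v" using assms(1) by (simp add: cong_iff_dvd_diff)
  moreover have "\<bar>u - v\<bar> < int p" using assms(2-4) by auto
  ultimately show ?thesis using dvd_imp_le_int[of "u - v" "int p"] by auto
qed

lemma Legendre_mult:
  assumes "prime p" "p > 2"
  shows "Legendre (x * y) (int p) = Legendre x (int p) * Legendre y (int p)"
proof (rule sign_eqI_cong)
  have "[Legendre (x * y) (int p) = x ^ ((p - 1) div 2) * y ^ ((p - 1) div 2)] (mod int p)"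
    using euler_criterion[OF assms, of "x * y"] by (simp add: power_mult_distrib)
  also have "[x ^ ((p - 1) div 2) * y ^ ((p - 1) div 2)
      = Legendre x (int p) * Legendre y (int p)] (mod int p)"
    by (intro cong_mult cong_sym[OF euler_criterion] assms)
  finally show "[Legendre (x * y) (int p) = Legendre x (int p) * Legendre y (int p)] (mod int p)" .
  show "Legendre x (int p) * Legendre y (int p) \<in> {- 1, 0, 1}"
    using Legendre_cases[of x "int p"] Legendre_cases[of y "int p"] by auto
qed (use assms Legendre_cases in auto)

lemma Legendre_1: "p > 2 \<Longrightarrow> Legendre 1 (int p) = 1"
  by (auto simp: Legendre_def QuadRes_def cong_0_iff intro: exI[of _ 1])

lemma Legendre_prod:
  assumes "prime p" "p > 2"
  shows "Legendre (\<Prod>i\<in>A. g i) (int p) = (\<Prod>i\<in>A. Legendre (g i) (int p))"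
  by (induction A rule: infinite_finite_induct) (simp_all add: Legendre_1 Legendre_mult assms)

lemma Legendre_power:
  assumes "prime p" "p > 2"
  shows "Legendre (x ^ n) (int p) = Legendre x (int p) ^ n"
  by (induction n) (simp_all add: Legendre_1 Legendre_mult assms)

lemma prime_cong_3_mod_4_gt_2:
  assumes "[p = 3] (mod 4)"
  shows "p > (2::nat)"
  using assms by (auto simp: cong_def not_less le_Suc_eq numeral_2_eq_2)

lemma Legendre_minus_one:
  assumes "prime p" "[p = 3] (mod 4)"
  shows "Legendre (- 1) (int p) = - 1"
proof (rule sign_eqI_cong)
  have gt: "p > 2" using assms(2) by (rule prime_cong_3_mod_4_gt_2)
  have "odd ((p - 1) div 2)" using assms(2) unfolding cong_def by presburger
  then show "[Legendre (- 1) (int p) = - 1] (mod int p)"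
    using euler_criterion[OF assms(1) gt, of "- 1"] by simp
qed (use prime_cong_3_mod_4_gt_2[OF assms(2)] Legendre_cases in auto)

text \<open>-1 is a nonresidue, so negation flips the symbol. It is applied below with
  \<open>q\<close> in the role of \<open>p\<close>.\<close>

lemma QuadRes_minus_iff:
  assumes "prime p" "[p = 3] (mod 4)" "\<not> int p dvd x"
  shows "QuadRes (int p) (- x) \<longleftrightarrow> \<not> QuadRes (int p) x"
proof -
  have "Legendre (- x) (int p) = - Legendre x (int p)"
    using Legendre_mult[of p "- 1" x] Legendre_minus_one assms prime_cong_3_mod_4_gt_2 by simp
  moreover have "Legendre x (int p) \<noteq> 0" using assms(3) by (simp add: Legendre_eq_0_iff)
  ultimately show ?thesis
    using Legendre_cases[of x "int p"] assms(3) by (auto simp: QuadRes_iff_Legendre)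
qed

section \<open>Factorials modulo a prime\<close>

text \<open>Wilson's theorem is the case \<open>k = 0\<close>. Each step trades the factor
  \<open>p - 1 - k\<close> for \<open>k + 1\<close>, its negative modulo \<open>p\<close>, and so
  changes the sign.\<close>

lemma fact_mult_fact_cong:
  assumes "prime p" "k < p"
  shows "[fact k * fact (p - 1 - k) = (- 1) ^ Suc k] (mod int p)"
  using assms(2)
proof (induction k)
  case 0
  then show ?case using wilson_theorem[OF assms(1)] by simp
next
  case (Suc k)
  let ?r = "p - 1 - Suc k"
  have r: "p - 1 - k = Suc ?r" using Suc.prems by simp
  have "int (Suc k) - (- int (Suc ?r)) = int p" using Suc.prems by simp
  then have c: "[int (Suc k) = - int (Suc ?r)] (mod int p)"
    by (simp only: cong_iff_dvd_diff dvd_refl)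
  have "[fact (Suc k) * fact ?r = - (fact k * fact (Suc ?r))] (mod int p)"
    using cong_scalar_right[OF c, of "fact k * fact ?r"]
    by (simp add: algebra_simps)
  also have "[- (fact k * fact (Suc ?r)) = - ((- 1) ^ Suc k)] (mod int p)"
    unfolding cong_minus_minus_iff using Suc.IH Suc.prems unfolding r by linarith
  finally show ?case by simp
qed

lemma Legendre_fact_reflect:
  assumes "prime p" "[p = 3] (mod 4)" "k < p" "even k"
  shows "Legendre (fact (p - 1 - k)) (int p) = - Legendre (fact k) (int p)"
proof -
  have gt: "p > 2" using assms(2) by (rule prime_cong_3_mod_4_gt_2)
  have "Legendre (fact k) (int p) * Legendre (fact (p - 1 - k)) (int p) = - 1"
    using Legendre_cong[OF fact_mult_fact_cong[OF assms(1,3)]] assms(4)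
    by (simp add: Legendre_mult[OF assms(1) gt] Legendre_minus_one[OF assms(1,2)])
  then show ?thesis
    using Legendre_cases[of "fact k" "int p"] by auto
qed

lemma Legendre_fact_square:
  assumes "prime p" "k < p"
  shows "Legendre (fact k) (int p) * Legendre (fact k) (int p) = 1"
proof -
  have "\<not> p dvd fact k" using assms by (simp add: prime_dvd_fact_iff)
  then have "\<not> int p dvd int (fact k)" by (simp only: int_dvd_int_iff not_False_eq_True)
  then have "Legendre (fact k) (int p) \<noteq> 0" by (simp add: Legendre_eq_0_iff)
  then show ?thesis using Legendre_cases[of "fact k" "int p"] by auto
qed

lemma mult_div_less:
  assumes "q dvd p - 1" "k \<le> q" "p > (0::nat)"
  shows "k * ((p - 1) div q) < p"
proof -
  have "k * ((p - 1) div q) \<le> q * ((p - 1) div q)" using assms(2) by (rule mult_le_mono1)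
  also have "\<dots> = p - 1" using assms(1) by simp
  finally show ?thesis using assms(3) by linarith
qed

lemma fact_mult_Pi_block:
  assumes "q dvd p - 1"
  shows "fact ((k - 1) * ((p - 1) div q)) * Pi_block p q k = fact (k * ((p - 1) div q))"
proof -
  let ?f = "(p - 1) div q"
  have d: "j * (p - 1) div q = j * ?f" for j
    using assms(1) by (simp add: div_mult_swap)
  have split: "{1..c} = {1..b} \<union> {b + 1..c}" if "b \<le> c" for b c :: nat
    using that by auto
  have "fact (k * ?f) = \<Prod>{1..k * ?f}" by (simp add: fact_prod)
  also have "{1..k * ?f} = {1..(k - 1) * ?f} \<union> {(k - 1) * ?f + 1..k * ?f}"
    by (intro split mult_le_mono1 diff_le_self)
  also have "\<Prod>\<dots> = \<Prod>{1..(k - 1) * ?f} * \<Prod>{(k - 1) * ?f + 1..k * ?f}"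
    by (rule prod.union_disjoint) auto
  finally show ?thesis unfolding Pi_block_def d by (simp only: fact_prod of_nat_id)
qed

text \<open>The block is a quotient of factorials, and a symbol with value 1 or -1 is its own
  inverse.\<close>

lemma Legendre_Pi_block:
  assumes "prime p" "p > 2" "q dvd p - 1" "k \<le> q"
  shows "Legendre (int (Pi_block p q k)) (int p)
    = Legendre (fact ((k - 1) * ((p - 1) div q))) (int p)
      * Legendre (fact (k * ((p - 1) div q))) (int p)"
proof -
  let ?f = "(p - 1) div q"
  have lt: "(k - 1) * ?f < p" using assms by (intro mult_div_less) auto
  have "int (fact (k * ?f)) = int (fact ((k - 1) * ?f)) * int (Pi_block p q k)"
    by (simp only: fact_mult_Pi_block[OF assms(3)] flip: of_nat_mult)
  then have "Legendre (fact (k * ?f)) (int p)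
      = Legendre (fact ((k - 1) * ?f)) (int p) * Legendre (int (Pi_block p q k)) (int p)"
    by (simp add: Legendre_mult[OF assms(1,2)])
  then show ?thesis
    using Legendre_fact_square[OF assms(1) lt] by (simp flip: mult.assoc)
qed

text \<open>For odd \<open>m\<close> the pairs \<open>{k - 1, k}\<close> with \<open>k\<close> odd
  partition \<open>{0..m}\<close>, and index 0 contributes the symbol of 0! = 1.\<close>

lemma Legendre_prod_odd_Pi_blocks:
  assumes "prime p" "p > 2" "q dvd p - 1" "odd m" "m \<le> q"
  shows "Legendre (int (\<Prod>k | k \<in> {1..m} \<and> odd k. Pi_block p q k)) (int p)
    = (\<Prod>i = 1..m. Legendre (fact (i * ((p - 1) div q))) (int p))"
proof -
  define F where "F = (\<lambda>i. Legendre (fact (i * ((p - 1) div q))) (int p))"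
  have F0: "F 0 = 1" using assms(2) by (simp add: F_def Legendre_1)
  have "(\<Prod>k | k \<in> {1..2 * t + 1} \<and> odd k. F (k - 1) * F k) = (\<Prod>i = 1..2 * t + 1. F i)" for t
  proof (induction t)
    case 0
    have "{k. k \<in> {1..2 * 0 + 1} \<and> odd k} = {1::nat}" by (auto simp: le_Suc_eq)
    then show ?case by (simp add: F0)
  next
    case (Suc t)
    have "{k. k \<in> {1..2 * Suc t + 1} \<and> odd k}
        = insert (2 * t + 3) {k. k \<in> {1..2 * t + 1} \<and> odd k}"
      by (auto simp: le_Suc_eq)
    then have "(\<Prod>k | k \<in> {1..2 * Suc t + 1} \<and> odd k. F (k - 1) * F k)
        = F (2 * t + 2) * F (2 * t + 3) * (\<Prod>k | k \<in> {1..2 * t + 1} \<and> odd k. F (k - 1) * F k)"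
      by simp
    also have "\<dots> = (\<Prod>i = 1..2 * Suc t + 1. F i)"
      unfolding Suc.IH by (simp add: numeral_3_eq_3)
    finally show ?case .
  qed
  moreover obtain t where "m = 2 * t + 1" using assms(4) by (elim oddE)
  ultimately have "(\<Prod>k | k \<in> {1..m} \<and> odd k. F (k - 1) * F k) = (\<Prod>i = 1..m. F i)" by simp
  moreover have "Legendre (int (\<Prod>k | k \<in> {1..m} \<and> odd k. Pi_block p q k)) (int p)
      = (\<Prod>k | k \<in> {1..m} \<and> odd k. F (k - 1) * F k)"
    unfolding of_nat_prod Legendre_prod[OF assms(1,2)] F_def
    using assms by (intro prod.cong Legendre_Pi_block) auto
  ultimately show ?thesis by (simp add: F_def)
qed

section \<open>Sets of representatives modulo the reflection at \<open>q\<close>\<close>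

text \<open>Both index sets contain exactly one element of each pair \<open>{i, q - i}\<close>, and
  \<open>g\<close> is constant on these pairs.\<close>

lemma prod_reflection_representatives:
  fixes g :: "nat \<Rightarrow> 'a::comm_monoid_mult"
  assumes "odd q" "N \<subseteq> {1..q - 1}"
    and N: "\<And>i. i \<in> {1..q - 1} \<Longrightarrow> q - i \<in> N \<longleftrightarrow> i \<notin> N"
    and g: "\<And>i. i \<in> {1..q - 1} \<Longrightarrow> g (q - i) = g i"
  shows "prod g N = prod g {1..(q - 1) div 2}"
proof (rule sym, rule prod.reindex_bij_witness)
  \<comment> \<open>\<open>?h\<close> picks the member of the pair that lies in \<open>N\<close>;
    its inverse \<open>?k\<close> picks the one in the lower half.\<close>
  let ?h = "\<lambda>i. if i \<in> N then i else q - i" and ?k = "\<lambda>i. if i \<le> (q - 1) div 2 then i else q - i"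
  have "i \<in> {1..(q - 1) div 2} \<Longrightarrow> i \<in> {1..q - 1} \<and> \<not> q - i \<le> (q - 1) div 2" for i
    using assms(1) by (auto elim!: oddE)
  then show "i \<in> {1..(q - 1) div 2} \<Longrightarrow> ?k (?h i) = i"
    "i \<in> {1..(q - 1) div 2} \<Longrightarrow> ?h i \<in> N" "i \<in> {1..(q - 1) div 2} \<Longrightarrow> g (?h i) = g i" for i
    using N[of i] g[of i] by (auto split: if_splits)
  fix j assume j: "j \<in> N"
  then have r: "j \<in> {1..q - 1}" using assms(2) by blast
  then show "?h (?k j) = j" using N[of j] j by auto
  show "?k j \<in> {1..(q - 1) div 2}" using r assms(1) by (auto elim!: oddE)
qed

lemma neg_square_indices_eq:
  assumes "prime q"
  shows "neg_square_indices q = {i \<in> {1..q - 1}. QuadRes (int q) (- int i)}"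
  unfolding neg_square_indices_def using unit_squares_iff_QuadRes[OF assms] by blast

lemma neg_square_indices_reflect:
  assumes "prime q" "[q = 3] (mod 4)" "i \<in> {1..q - 1}"
  shows "q - i \<in> neg_square_indices q \<longleftrightarrow> i \<notin> neg_square_indices q"
proof -
  have "- int (q - i) = int i - int q" using assms(3) by (auto simp: of_nat_diff)
  then have "QuadRes (int q) (- int (q - i)) \<longleftrightarrow> QuadRes (int q) (int i)"
    by (simp add: QuadRes_def cong_def)
  moreover have "\<not> int q dvd int i" using assms(3) by (auto dest: dvd_imp_le)
  moreover have "q - i \<in> {1..q - 1}" using assms(3) by auto
  ultimately show ?thesis
    using assms(3) QuadRes_minus_iff[OF assms(1,2), of "int i"]
    by (simp add: neg_square_indices_eq[OF assms(1)])
qed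

lemma minus_one_power_beta:
  assumes "prime q" "[q = 3] (mod 4)"
  shows "(- 1 :: int) ^ nat \<lfloor>beta q\<rfloor> = (- 1) ^ \<Sum>(neg_square_indices q)"
proof (cases "q = 3")
  case True
  \<comment> \<open>For \<open>q = 3\<close> the index set is \<open>{2}\<close> and the floor of
    2/3 is 0, so both exponents are even.\<close>
  have "QuadRes 3 (- 2)" by (auto simp: QuadRes_def cong_def intro!: exI[of _ 1])
  then have "2 \<in> neg_square_indices q"
    using assms(1) unfolding neg_square_indices_eq[OF assms(1)] by (simp add: True)
  moreover have "neg_square_indices q \<subseteq> {1, 2}"
    unfolding neg_square_indices_def True by auto
  moreover have "1 \<notin> neg_square_indices q"
    using neg_square_indices_reflect[OF assms, of 1] calculation(1) by (simp add: True)
  ultimately have "neg_square_indices q = {2}" by auto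
  then show ?thesis by (simp add: beta_def True)
next
  case False
  let ?S = "\<Sum>(neg_square_indices q)"
  have gt: "q > 3" using False prime_cong_3_mod_4_gt_2[OF assms(2)] by simp
  have "of_int \<lfloor>beta q\<rfloor> = beta q"
    using assms gt by (intro beta_integral) (simp_all add: cong_def)
  moreover have b: "of_nat q * beta q = of_nat ?S" using gt by (simp add: beta_def)
  moreover have nn: "\<lfloor>beta q\<rfloor> \<ge> 0" by (simp add: beta_def sum_nonneg)
  ultimately have "(of_nat (q * nat \<lfloor>beta q\<rfloor>) :: rat) = of_nat ?S"
    by (simp only: of_nat_mult of_nat_nat)
  then have "q * nat \<lfloor>beta q\<rfloor> = ?S" by (simp only: of_nat_eq_iff)
  moreover have "odd q" using assms(2) unfolding cong_def by presburger
  \<comment> \<open>The sum is \<open>q\<close> times \<open>beta q\<close>, and the odd factor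
    \<open>q\<close> does not affect parity.\<close>
  ultimately show ?thesis by (metis power_mult power_minus_odd power_one)
qed

lemma minus_one_power_triangle:
  assumes "[q = 3] (mod 4)"
  shows "(\<Prod>i = 1..(q - 1) div 2. (- 1 :: int) ^ i) = (- 1) ^ ((q + 1) div 4)"
proof -
  define t where "t = q div 4"
  have t: "q = 4 * t + 3" using assms unfolding t_def cong_def by presburger
  \<comment> \<open>Each induction step adds the exponents \<open>2 * t + 2\<close> and
    \<open>2 * t + 3\<close>, whose sum is odd.\<close>
  have "(\<Prod>i = 1..2 * t + 1. (- 1 :: int) ^ i) = (- 1) ^ (t + 1)"
    by (induction t) (simp_all add: power_add)
  moreover have "(q - 1) div 2 = 2 * t + 1" "(q + 1) div 4 = t + 1" by (simp_all add: t)
  ultimately show ?thesis by simp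
qed

section \<open>Comparison of the two products\<close>

lemma Legendre_neg_square_factorials:
  assumes "prime p" "prime q" "[q = 3] (mod 4)" "[p = 1] (mod q)" "[p = 3] (mod 4)"
  shows "Legendre ((- 1) ^ nat \<lfloor>beta q\<rfloor> *
      int (\<Prod>i \<in> neg_square_indices q. fact (i * ((p - 1) div q)))) (int p)
    = (- 1) ^ ((q + 1) div 4) *
      (\<Prod>i = 1..(q - 1) div 2. Legendre (fact (i * ((p - 1) div q))) (int p))"
proof -
  let ?N = "neg_square_indices q" and ?f = "(p - 1) div q"
  let ?F = "\<lambda>i. Legendre (fact (i * ?f)) (int p)"
  have p2: "p > 2" using assms(5) by (rule prime_cong_3_mod_4_gt_2)
  have odd: "odd q" "odd p" using assms(3,5) unfolding cong_def by presburger+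
  have dvd: "q dvd p - 1" using assms(4) by (rule cong_to_1_nat)
  then have qf: "q * ?f = p - 1" by simp
  then have "even (q * ?f)" using odd by simp
  \<comment> \<open>This makes \<open>i * ?f\<close> even, as the reflection of factorials
    requires.\<close>
  then have ev: "even ?f" using odd by simp
  \<comment> \<open>Both factors change sign under the reflection: the power because
    \<open>q\<close> is odd, the symbol by Wilson's theorem.\<close>
  have refl: "(- 1) ^ (q - i) * ?F (q - i) = (- 1) ^ i * ?F i" if i: "i \<in> {1..q - 1}" for i
  proof -
    have lt: "i * ?f < p" using i p2 by (intro mult_div_less dvd) auto
    have "(q - i) * ?f = p - 1 - i * ?f" by (simp only: diff_mult_distrib qf)
    then have "?F (q - i) = - ?F i"
      using Legendre_fact_reflect[OF assms(1,5) lt] ev by simp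
    moreover have "even (q - i) \<longleftrightarrow> odd i" using odd i by (auto simp: even_diff_nat)
    ultimately show ?thesis by (simp add: minus_one_power_iff)
  qed
  \<comment> \<open>As -1 has symbol -1 modulo \<open>p\<close>, the power of -1 passes through the
    symbol unchanged.\<close>
  have "Legendre ((- 1) ^ nat \<lfloor>beta q\<rfloor> * int (\<Prod>i \<in> ?N. fact (i * ?f))) (int p)
      = (- 1) ^ \<Sum>?N * (\<Prod>i \<in> ?N. ?F i)"
    by (simp add: Legendre_mult Legendre_power Legendre_prod Legendre_minus_one assms(1,5) p2
        minus_one_power_beta[OF assms(2,3)])
  also have "\<dots> = (\<Prod>i \<in> ?N. (- 1) ^ i * ?F i)"
    by (simp add: power_sum prod.distrib)
  also have "\<dots> = (\<Prod>i = 1..(q - 1) div 2. (- 1) ^ i * ?F i)"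
    by (intro prod_reflection_representatives odd refl neg_square_indices_reflect assms)
       (auto simp: neg_square_indices_def)
  also have "\<dots> = (- 1) ^ ((q + 1) div 4) * (\<Prod>i = 1..(q - 1) div 2. ?F i)"
    by (simp only: prod.distrib minus_one_power_triangle[OF assms(3)])
  finally show ?thesis .
qed

theorem theorem2:
  fixes p q :: nat and a b :: int
  assumes "prime p" and "prime q"
    and "[q = 3] (mod 4)" and "[p = 1] (mod q)" and "[p = 3] (mod 4)"
    and "4 * int p ^ class_number (quadratic_field (- int q)) = a\<^sup>2 + int q * b\<^sup>2"
    and "[a = 2] (mod int q)"
    and "coprime a (int p)"
  shows
    "(QuadRes (int p)
        (int (\<Prod>k \<in> {k \<in> {1..(q - 1) div 2}. [(q + 1) div 2 - k = 1] (mod 2)}. Pi_block p q k))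
      \<longleftrightarrow>
      Legendre a (int p) =
        Legendre ((- 1) ^ nat \<lfloor>beta q\<rfloor> *
          int (\<Prod>i \<in> neg_square_indices q. fact (i * ((p - 1) div q)))) (int p))
     \<longleftrightarrow>
     Legendre a (int p) = (- 1) ^ ((q + 1) div 4)"
proof -
  let ?m = "(q - 1) div 2"
  let ?F = "\<lambda>i. Legendre (fact (i * ((p - 1) div q))) (int p)"
  let ?P = "int (\<Prod>k \<in> {k \<in> {1..?m}. [(q + 1) div 2 - k = 1] (mod 2)}. Pi_block p q k)"
  have p2: "p > 2" using assms(5) by (rule prime_cong_3_mod_4_gt_2)
  have dvd: "q dvd p - 1" using assms(4) by (rule cong_to_1_nat)
  have m: "odd ?m" "?m \<le> q" "(q + 1) div 2 = Suc ?m"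
    using assms(3) unfolding cong_def by presburger+
  \<comment> \<open>It is used with \<open>n = ?m\<close>: there \<open>Suc n\<close> is even and
    \<open>k \<le> n\<close> rules out truncation, so the difference has the parity of
    \<open>k\<close>.\<close>
  have odd_iff: "[Suc n - k = 1] (mod 2) \<longleftrightarrow> odd k" if "odd n" "k \<le> n" for n k :: nat
  proof -
    have "odd (Suc n - k) \<longleftrightarrow> odd k" using that by (simp add: Suc_diff_le)
    then show ?thesis unfolding cong_def odd_iff_mod_2_eq_one by simp
  qed
  have "{k \<in> {1..?m}. [(q + 1) div 2 - k = 1] (mod 2)} = {k. k \<in> {1..?m} \<and> odd k}"
    unfolding m(3) by (intro Collect_cong conj_cong refl odd_iff m(1)) simp
  then have LP: "Legendre ?P (int p) = (\<Prod>i = 1..?m. ?F i)"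
    using Legendre_prod_odd_Pi_blocks[OF assms(1) p2 dvd m(1,2)] by simp
  have "?F i \<noteq> 0" if "i \<in> {1..?m}" for i
  proof -
    have "i * ((p - 1) div q) < p" using that p2 m(2) by (intro mult_div_less dvd) auto
    then show ?thesis using Legendre_fact_square[OF assms(1)] by fastforce
  qed
  then have nz: "Legendre ?P (int p) \<noteq> 0" unfolding LP by simp
  have "\<not> int p dvd a"
    using coprime_common_divisor[OF assms(8), of "int p"] p2 by auto
  then have "Legendre a (int p) \<noteq> 0" by (simp add: Legendre_eq_0_iff)
  then have La: "Legendre a (int p) \<in> {- 1, 1}" using Legendre_cases[of a "int p"] by blast
  have LP_sign: "Legendre ?P (int p) \<in> {- 1, 1}" using nz Legendre_cases[of ?P "int p"] by blast
  have s: "(- 1 :: int) ^ ((q + 1) div 4) \<in> {- 1, 1}"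
    by (simp add: minus_one_power_iff)
  \<comment> \<open>For \<open>y = 1\<close> the inner equation is \<open>x = s\<close>. For
    \<open>y = -1\<close> the biconditional denies \<open>x = -s\<close>, which for signs again
    means \<open>x = s\<close>.\<close>
  have cancel: "(y = 1 \<longleftrightarrow> x = s * y) \<longleftrightarrow> x = s"
    if "x \<in> {- 1, 1}" "y \<in> {- 1, 1}" "s \<in> {- 1, 1}" for x y s :: int
    using that by auto
  have QR: "QuadRes (int p) ?P \<longleftrightarrow> Legendre ?P (int p) = 1"
    using nz by (intro QuadRes_iff_Legendre) (simp only: Legendre_eq_0_iff not_False_eq_True)
  show ?thesis
    unfolding QR Legendre_neg_square_factorials[OF assms(1-5)] LP[symmetric]
    by (rule cancel[OF La LP_sign s])
qed

end
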